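(* An $N\times N$ tw-matrix $A$ is tw-singular if and only if there is a vector $\mathbf{x}\in\mathbb{R}^N$ in its tw-kernel.
   Context: A $K\times N$ tw-matrix (tropical weighted matrix) $A$ is an $M\times N$ matrix with entries in $\mathbb{T}$ (as a set, $\mathbb{T}=\mathbb{R}$), together with integers $m_1,\dots,m_M\ge 1$ (weights of the rows) with $\sum_{i=1}^M m_i=K$. A vector $\mathbf{x}=(x_1,\dots,x_N)$ is in the tw-kernel of $A$ if for each row $i$ the minimum $\min_j\{x_j+A_{ij}\}$ is achieved by at least $m_i+1$ indices $j$. The tw-permanent of an $N\times N$ tw-matrix $A$ is $\min_{\mathcal{I}}\{\sum_i\sum_{j\in I_i}A_{ij}\}$, the minimum over all partitions $\mathcal{I}=(I_1,\dots,I_M)$ of $\{1,\dots,N\}$ into labelled subsets with $|I_i|=m_i$. $A$ is tw-singular if this minimum is achieved by more than one $\mathcal{I}$, and tw-nonsingular otherwise. *)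

theory Defs
  imports "HOL-Analysis.Analysis"
begin

text \<open>
  A tw-matrix is given by its matrix of entries \<open>A\<close> and its row weights \<open>w\<close>. The rows are indexed
  by \<open>'m\<close> and the columns by \<open>'n\<close>, so that \<open>N = CARD('n)\<close>, while \<open>K\<close> is the sum of the weights
  and not the number of rows. As a set, the tropical semiring is \<open>\<real>\<close> (no infinite element).
\<close>

definition tw_matrix :: "nat \<Rightarrow> real ^ 'n ^ 'm \<Rightarrow> ('m::finite \<Rightarrow> nat) \<Rightarrow> bool" where
  "tw_matrix K A w \<longleftrightarrow> (\<forall>i. w i \<ge> 1) \<and> (\<Sum>i\<in>UNIV. w i) = K"

definition tw_kernel :: "real ^ 'n ^ 'm \<Rightarrow> ('m::finite \<Rightarrow> nat) \<Rightarrow> (real ^ 'n) set" where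
  "tw_kernel A w =
    {x. \<forall>i. card {j. x $ j + A $ i $ j = Min (range (\<lambda>k. x $ k + A $ i $ k))} \<ge> w i + 1}"

definition tw_partitions :: "('m \<Rightarrow> nat) \<Rightarrow> ('m \<Rightarrow> 'n set) set" where
  "tw_partitions w =
    {I. disjoint_family I \<and> (\<Union>i. I i) = UNIV \<and> (\<forall>i. card (I i) = w i)}"

definition tw_cost :: "real ^ 'n ^ 'm \<Rightarrow> ('m::finite \<Rightarrow> 'n set) \<Rightarrow> real" where
  "tw_cost A I = (\<Sum>i\<in>UNIV. \<Sum>j\<in>I i. A $ i $ j)"

text \<open>
  The next two notions are meant for \<open>N \<times> N\<close> tw-matrices, \<open>tw_matrix CARD('n) A w\<close>; then the set of
  partitions is finite and nonempty, and the minimum is well-defined.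
\<close>

definition tw_permanent :: "real ^ 'n ^ 'm \<Rightarrow> ('m::finite \<Rightarrow> nat) \<Rightarrow> real" where
  "tw_permanent A w = Min (tw_cost A ` tw_partitions w)"

definition tw_singular :: "real ^ 'n ^ 'm \<Rightarrow> ('m::finite \<Rightarrow> nat) \<Rightarrow> bool" where
  "tw_singular A w \<longleftrightarrow>
    (\<exists>I \<in> tw_partitions w. \<exists>J \<in> tw_partitions w.
      I \<noteq> J \<and> tw_cost A I = tw_permanent A w \<and> tw_cost A J = tw_permanent A w)"

end

theory Submission
  imports Defs
begin

text \<open>
  A partition of the columns with block sizes \<open>w\<close> is the same thing as a map \<open>p\<close> from columns to
  rows whose fibres have sizes \<open>w\<close>, and its cost is the sum of the entries \<open>A\<^sub>p\<^sub>(\<^sub>j\<^sub>)\<^sub>,\<^sub>j\<close>. So the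
  matrix is tw-singular iff two different such assignments have minimal cost.

  Let \<open>x\<close> be in the kernel and \<open>p\<close> an optimal assignment. Row \<open>i\<close> has more than \<open>w i\<close> columns
  attaining its minimum, so one of them, \<open>f i\<close>, is not assigned to row \<open>i\<close>. The self-map
  \<open>i \<mapsto> p (f i)\<close> of the rows has no fixed point but, the rows being finitely many, permutes some
  nonempty set \<open>S\<close> of rows. Handing \<open>f i\<close> over to row \<open>i\<close> for all \<open>i \<in> S\<close> is therefore a
  reassignment that preserves the fibre sizes. After the change of potential
  \<open>A\<^sub>i\<^sub>j + x\<^sub>j - \<mu>\<^sub>i\<close>, where \<open>\<mu>\<^sub>i\<close> is the minimum of row \<open>i\<close>, all entries are nonnegative and
  the new positions have entry zero; so the new assignment, which differs from \<open>p\<close>, is also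
  optimal (lemma \<open>kernel_imp_second_optimum\<close>).

  Conversely let \<open>p \<noteq> q\<close> be optimal. The kernel vector comes from a tropical Cramer rule. Choose
  a row \<open>c\<close> whose fibres under \<open>p\<close> and \<open>q\<close> differ, lower the weight of \<open>c\<close> by one, and let
  \<open>x\<^sub>j\<close> be the tropical minor that omits column \<open>j\<close>. Then \<open>x\<^sub>j + A\<^sub>i\<^sub>j\<close> is the least cost of a
  map that sends \<open>j\<close> to \<open>i\<close> and has fibre sizes \<open>w\<close>, except one more at \<open>i\<close> and one less at
  \<open>c\<close>. Given a cheapest map \<open>r\<close> with these fibre sizes, all columns in the fibre of \<open>r\<close> over
  \<open>i\<close> thus attain the minimum of row \<open>i\<close> (lemma \<open>cramer_fibre_attains_min\<close>). For \<open>i \<noteq> c\<close> this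
  fibre has \<open>w i + 1\<close> elements. For \<open>i = c\<close> the two changes cancel, so both \<open>p\<close> and \<open>q\<close> are cheapest, and their two
  different fibres of size \<open>w c\<close> together have at least \<open>w c + 1\<close> elements.
\<close>

section \<open>Partitions as assignments of columns to rows\<close>

definition assignments :: "('m \<Rightarrow> nat) \<Rightarrow> ('n \<Rightarrow> 'm) set" where
  "assignments w = {p. \<forall>i. card {j. p j = i} = w i}"

definition assignment_cost :: "real ^ 'n ^ 'm \<Rightarrow> ('n \<Rightarrow> 'm::finite) \<Rightarrow> real" where
  "assignment_cost A p = (\<Sum>j\<in>UNIV. A $ p j $ j)"

definition optimal_assignment ::
    "real ^ 'n ^ 'm \<Rightarrow> ('m::finite \<Rightarrow> nat) \<Rightarrow> ('n \<Rightarrow> 'm) \<Rightarrow> bool" where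
  "optimal_assignment A w p \<longleftrightarrow>
    p \<in> assignments w \<and> (\<forall>r\<in>assignments w. assignment_cost A p \<le> assignment_cost A r)"

definition fibres :: "('n \<Rightarrow> 'm) \<Rightarrow> 'm \<Rightarrow> 'n set" where
  "fibres p i = {j. p j = i}"

lemma fibres_eq_iff: "fibres p = fibres q \<longleftrightarrow> p = q"
  by (auto simp: fibres_def fun_eq_iff)

lemma tw_partitions_eq: "tw_partitions w = fibres ` assignments w"
proof (intro equalityI subsetI)
  fix I assume I: "I \<in> tw_partitions w"
  have "\<forall>j. \<exists>i. j \<in> I i"
    using I by (auto simp: tw_partitions_def)
  then obtain p where p: "\<And>j. j \<in> I (p j)" by metis
  have "fibres p = I"
  proof
    fix i
    have "p j = i" if "j \<in> I i" for j
      using I p[of j] that by (auto simp: tw_partitions_def disjoint_family_on_def)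
    then show "fibres p i = I i"
      using p by (auto simp: fibres_def)
  qed
  moreover from this have "p \<in> assignments w"
    using I by (auto simp: tw_partitions_def assignments_def fibres_def fun_eq_iff)
  ultimately show "I \<in> fibres ` assignments w" by blast
next
  fix I assume "I \<in> fibres ` assignments w"
  then show "I \<in> tw_partitions w"
    by (auto simp: tw_partitions_def assignments_def fibres_def disjoint_family_on_def)
qed

lemma tw_cost_fibres: "tw_cost A (fibres p) = assignment_cost A p"
proof -
  have "(\<Sum>j\<in>fibres p i. A $ i $ j) = (\<Sum>j\<in>{j\<in>UNIV. p j = i}. A $ p j $ j)" for i
    by (rule sum.cong) (auto simp: fibres_def)
  then have "tw_cost A (fibres p) = (\<Sum>i\<in>UNIV. \<Sum>j\<in>{j\<in>UNIV. p j = i}. A $ p j $ j)"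
    by (simp add: tw_cost_def)
  also have "\<dots> = assignment_cost A p"
    unfolding assignment_cost_def by (rule sum.group) auto
  finally show ?thesis .
qed

lemma assignments_nonempty:
  fixes w :: "'m::finite \<Rightarrow> nat"
  assumes "(\<Sum>i\<in>UNIV. w i) = CARD('n::finite)"
  shows "(assignments w :: ('n \<Rightarrow> 'm) set) \<noteq> {}"
proof -
  let ?D = "SIGMA i:UNIV. {..<w i}"
  have "card ?D = CARD('n)" using assms by simp
  moreover have "finite ?D" by simp
  ultimately obtain h where h: "bij_betw h (UNIV :: 'n set) ?D"
    using finite_same_card_bij[of "UNIV :: 'n set" ?D] by auto
  have "card {j. fst (h j) = i} = w i" for i
  proof -
    have "h ` {j. fst (h j) = i} = {d \<in> range h. fst d = i}" by auto
    also have "\<dots> = {d \<in> ?D. fst d = i}"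
      using h by (simp add: bij_betw_def)
    also have "\<dots> = {i} \<times> {..<w i}" by auto
    finally have "bij_betw h {j. fst (h j) = i} ({i} \<times> {..<w i})"
      using bij_betw_subset[OF h] by blast
    then have "card {j. fst (h j) = i} = card ({i} \<times> {..<w i})"
      by (rule bij_betw_same_card)
    then show ?thesis by (simp add: card_cartesian_product)
  qed
  then have "fst \<circ> h \<in> assignments w" by (simp add: assignments_def)
  then show ?thesis by blast
qed

lemma tw_singular_iff_two_optimal:
  fixes A :: "real ^ 'n ^ 'm"
  assumes "(assignments w :: ('n \<Rightarrow> 'm) set) \<noteq> {}"
  shows "tw_singular A w \<longleftrightarrow>
    (\<exists>p q. p \<noteq> q \<and> optimal_assignment A w p \<and> optimal_assignment A w q)"
proof -
  have costs: "tw_cost A ` tw_partitions w = assignment_cost A ` assignments w"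
    by (simp add: tw_partitions_eq image_image tw_cost_fibres)
  have "optimal_assignment A w p \<longleftrightarrow>
      p \<in> assignments w \<and> assignment_cost A p = tw_permanent A w" for p
    unfolding optimal_assignment_def tw_permanent_def costs
    using assms by (auto simp: eq_Min_iff)
  then show ?thesis
    unfolding tw_singular_def tw_partitions_eq bex_simps tw_cost_fibres fibres_eq_iff by blast
qed

lemma ex_optimal_assignment:
  fixes A :: "real ^ 'n ^ 'm"
  assumes "(assignments w :: ('n \<Rightarrow> 'm) set) \<noteq> {}"
  shows "\<exists>p. optimal_assignment A w p"
proof -
  obtain p where "is_arg_min (assignment_cost A) (\<lambda>r. r \<in> assignments w) p"
    using ex_is_arg_min_if_finite[OF finite assms] by blast
  then show ?thesis
    unfolding is_arg_min_linorder optimal_assignment_def by blast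
qed

section \<open>A kernel vector yields a second optimum\<close>

text \<open>
  A minimal nonempty invariant set works: the image of an invariant set is again invariant.
\<close>

lemma finite_selfmap_permutes_subset:
  fixes s :: "'a::finite \<Rightarrow> 'a"
  obtains S where "S \<noteq> {}" "bij_betw s S S"
proof -
  let ?F = "{S. S \<noteq> {} \<and> s ` S \<subseteq> S}"
  have "UNIV \<in> ?F" by simp
  then have "?F \<noteq> {}" by (metis empty_iff)
  from finite_has_minimal[OF finite this]
  obtain S where S: "S \<in> ?F" and min: "\<forall>T\<in>?F. T \<subseteq> S \<longrightarrow> S = T" ..
  have "s ` S \<in> ?F" "s ` S \<subseteq> S" using S by (simp_all add: image_mono)
  then have "s ` S = S" using min by metis
  then have "bij_betw s S S" by (simp add: bij_betw_def eq_card_imp_inj_on)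
  with S show thesis by (intro that[of S]) auto
qed

lemma assignments_comp_bij:
  assumes "p \<in> assignments w" "bij \<tau>"
  shows "p \<circ> \<tau> \<in> assignments w"
proof -
  have "card {j. p (\<tau> j) = i} = card {j. p j = i}" for i
  proof (rule bij_betw_same_card)
    have "\<tau> ` {j. p (\<tau> j) = i} = {j \<in> range \<tau>. p j = i}" by auto
    also have "\<dots> = {j. p j = i}"
      using assms(2) by (simp add: bij_is_surj)
    finally show "bij_betw \<tau> {j. p (\<tau> j) = i} {j. p j = i}"
      using bij_betw_subset[OF assms(2)] by blast
  qed
  then show ?thesis
    using assms(1) by (simp add: assignments_def)
qed

text \<open>
  The rows of \<open>S\<close> exchange columns along the permutation \<open>i \<mapsto> p (f i)\<close> of \<open>S\<close>. Writing the result
  as \<open>p \<circ> \<tau>\<close> for a permutation \<open>\<tau>\<close> of the columns makes it evident that fibre sizes are kept, and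
  more generally that sums \<open>\<Sum>\<^sub>j \<mu> (p j)\<close> are.
\<close>

lemma exchange_along_permuted_rows:
  fixes p :: "'n::finite \<Rightarrow> 'm"
  assumes S: "bij_betw (\<lambda>i. p (f i)) S S"
  obtains \<tau> where "bij \<tau>" "\<And>i. i \<in> S \<Longrightarrow> p (\<tau> (f i)) = i" "\<And>j. j \<notin> f ` S \<Longrightarrow> \<tau> j = j"
proof -
  define \<sigma> where "\<sigma> j = (if j \<in> f ` S then f (p j) else j)" for j
  have img: "p ` f ` S = S"
    using S by (auto simp: bij_betw_def image_image)
  have "\<exists>j. \<sigma> j = k" for k
  proof (cases "k \<in> f ` S")
    case True
    then have "k \<in> f ` p ` f ` S" using img by simp
    then obtain j where "j \<in> f ` S" "k = f (p j)" by blast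
    then have "\<sigma> j = k" by (simp add: \<sigma>_def)
    then show ?thesis ..
  next
    case False
    then have "\<sigma> k = k" by (simp add: \<sigma>_def)
    then show ?thesis ..
  qed
  then have "surj \<sigma>" by (metis surjI)
  then have bij: "bij \<sigma>"
    by (simp add: bij_def finite_UNIV_surj_inj)
  show thesis
  proof (rule that[of "inv \<sigma>"])
    show "bij (inv \<sigma>)" using bij by (rule bij_imp_bij_inv)
    show "p (inv \<sigma> (f i)) = i" if "i \<in> S" for i
    proof -
      have "i \<in> p ` f ` S" using that by (simp add: img)
      then obtain k where k: "k \<in> S" "i = p (f k)" by blast
      then have "\<sigma> (f k) = f i" by (simp add: \<sigma>_def)
      then have "inv \<sigma> (f i) = f k"
        using bij_inv_eq_iff[OF bij, of "f k" "f i"] by simp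
      then show ?thesis using k by simp
    qed
    show "inv \<sigma> j = j" if "j \<notin> f ` S" for j
      using bij_inv_eq_iff[OF bij, of j j] that by (simp add: \<sigma>_def)
  qed
qed

lemma kernel_imp_second_optimum:
  fixes A :: "real ^ 'n ^ 'm"
  assumes x: "x \<in> tw_kernel A w" and p: "optimal_assignment A w p"
  shows "\<exists>q. q \<noteq> p \<and> optimal_assignment A w q"
proof -
  define \<mu> where "\<mu> i = Min (range (\<lambda>k. x $ k + A $ i $ k))" for i
  have "\<exists>j. x $ j + A $ i $ j = \<mu> i \<and> p j \<noteq> i" for i
  proof (rule ccontr)
    assume "\<not> ?thesis"
    then have "card {j. x $ j + A $ i $ j = \<mu> i} \<le> card {j. p j = i}"
      by (intro card_mono) auto
    moreover have "card {j. x $ j + A $ i $ j = \<mu> i} \<ge> w i + 1"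
      using x by (auto simp: tw_kernel_def \<mu>_def)
    ultimately show False
      using p by (simp add: optimal_assignment_def assignments_def)
  qed
  then obtain f where f: "\<And>i. x $ f i + A $ i $ f i = \<mu> i" "\<And>i. p (f i) \<noteq> i"
    by metis
  obtain S where S: "S \<noteq> {}" "bij_betw (\<lambda>i. p (f i)) S S"
    by (rule finite_selfmap_permutes_subset)
  obtain \<tau> where \<tau>: "bij \<tau>" "\<And>i. i \<in> S \<Longrightarrow> p (\<tau> (f i)) = i" "\<And>j. j \<notin> f ` S \<Longrightarrow> \<tau> j = j"
    by (rule exchange_along_permuted_rows[where p = p and f = f, OF S(2)]) blast
  define q where "q = p \<circ> \<tau>"
  obtain i where "i \<in> S" using S(1) by blast
  then have "q (f i) \<noteq> p (f i)"
    using \<tau>(2) f(2) by (metis comp_apply q_def)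
  then have "q \<noteq> p" by auto
  have "q \<in> assignments w"
    using p \<tau>(1) by (simp add: q_def optimal_assignment_def assignments_comp_bij)
  have nonneg: "0 \<le> A $ i $ j + x $ j - \<mu> i" for i j
    by (simp add: \<mu>_def add.commute)
  have reduced: "(\<Sum>j\<in>UNIV. A $ r j $ j + x $ j - \<mu> (r j))
      = assignment_cost A r + (\<Sum>j\<in>UNIV. x $ j) - (\<Sum>j\<in>UNIV. \<mu> (r j))" for r
    by (simp add: assignment_cost_def sum.distrib sum_subtractf)
  have "(\<Sum>j\<in>UNIV. A $ q j $ j + x $ j - \<mu> (q j)) \<le> (\<Sum>j\<in>UNIV. A $ p j $ j + x $ j - \<mu> (p j))"
  proof (rule sum_mono)
    fix j
    show "A $ q j $ j + x $ j - \<mu> (q j) \<le> A $ p j $ j + x $ j - \<mu> (p j)"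
    proof (cases "j \<in> f ` S")
      case True
      then obtain i where "i \<in> S" "j = f i" by blast
      then have "A $ q j $ j + x $ j - \<mu> (q j) = 0"
        using \<tau>(2) f(1)[of i] by (simp add: q_def)
      then show ?thesis using nonneg by simp
    next
      case False
      then show ?thesis using \<tau>(3) by (simp add: q_def)
    qed
  qed
  moreover have "(\<Sum>j\<in>UNIV. \<mu> (q j)) = (\<Sum>j\<in>UNIV. \<mu> (p j))"
    using sum.reindex_bij_betw[OF \<tau>(1), of "\<lambda>j. \<mu> (p j)"] by (simp add: q_def)
  ultimately have "assignment_cost A q \<le> assignment_cost A p"
    by (simp add: reduced)
  then have "optimal_assignment A w q"
    using p \<open>q \<in> assignments w\<close> unfolding optimal_assignment_def by force
  then show ?thesis using \<open>q \<noteq> p\<close> by blast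
qed

section \<open>A kernel vector from the tropical Cramer rule\<close>

lemma assignment_cost_fun_upd:
  "assignment_cost A (r(j := c)) + A $ r j $ j = assignment_cost A r + A $ c $ j"
  by (simp add: assignment_cost_def sum.remove[of UNIV j])

lemma card_fibre_fun_upd:
  fixes r :: "'n::finite \<Rightarrow> 'm"
  shows "card {l. (r(j := c)) l = k} + of_bool (k = r j) = card {l. r l = k} + of_bool (k = c)"
proof -
  let ?B = "{l. l \<noteq> j \<and> r l = k}"
  have "{l. (r(j := c)) l = k} = (if k = c then insert j ?B else ?B)"
       "{l. r l = k} = (if k = r j then insert j ?B else ?B)"
    by auto
  then show ?thesis by simp
qed

text \<open>
  The right-hand side describes the maps with fibre sizes \<open>w\<close>, except one more at \<open>i\<close> and one less at
  \<open>c\<close>. The point is that it does not depend on \<open>j\<close>: every column of the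
  fibre over \<open>i\<close> is equally good for moving back to \<open>c\<close>.
\<close>

lemma fun_upd_in_assignments_iff:
  fixes r :: "'n::finite \<Rightarrow> 'm"
  assumes "r j = i"
  shows "r(j := c) \<in> assignments w \<longleftrightarrow>
    (\<forall>k. card {l. r l = k} + of_bool (k = c) = w k + of_bool (k = i))"
proof -
  have "card {l. (r(j := c)) l = k} = w k \<longleftrightarrow>
      card {l. r l = k} + of_bool (k = c) = w k + of_bool (k = i)" for k
    using card_fibre_fun_upd[of r j c k] assms
    by (metis add_right_cancel)
  then show ?thesis by (simp add: assignments_def)
qed

text \<open>
  The least cost of assigning all columns but \<open>j\<close> when row \<open>c\<close> has one column less to receive:
  \<open>j\<close> is put into row \<open>c\<close> and its contribution is taken off again.
\<close>

definition cramer_vector ::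
    "real ^ 'n ^ 'm \<Rightarrow> ('m::finite \<Rightarrow> nat) \<Rightarrow> 'm \<Rightarrow> real ^ 'n" where
  "cramer_vector A w c =
    (\<chi> j. Min (assignment_cost A ` {r \<in> assignments w. r j = c}) - A $ c $ j)"

lemma assignment_with_prescribed_value:
  fixes p :: "'n::finite \<Rightarrow> 'm" and j :: 'n
  assumes "p \<in> assignments w" "w c \<ge> 1"
  shows "\<exists>r\<in>assignments w. r j = c"
proof -
  have "card {l. p l = c} > 0" using assms by (auto simp: assignments_def)
  then obtain l where "p l = c" by (auto simp: card_gt_0_iff)
  then show ?thesis
    using assignments_comp_bij[OF assms(1), of "Transposition.transpose j l"]
    by (intro bexI[of _ "p \<circ> Transposition.transpose j l"]) auto
qed

text \<open>
  The sum \<open>cramer_vector A w c $ k + A $ i $ k\<close> is the least cost of a map in the set over which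
  \<open>r\<close> is cheapest, subject to sending \<open>k\<close> to \<open>i\<close>. It is therefore at least the cost of \<open>r\<close>, with
  equality when \<open>r\<close> itself sends \<open>k\<close> to \<open>i\<close>.
\<close>

lemma cramer_fibre_attains_min:
  fixes A :: "real ^ 'n ^ 'm"
  assumes ne: "\<And>k::'n. \<exists>t\<in>assignments w. t k = c"
    and r: "r j\<^sub>0 = i" "r(j\<^sub>0 := c) \<in> assignments w"
    and cheapest: "\<And>t k. t k = i \<Longrightarrow> t(k := c) \<in> assignments w \<Longrightarrow>
      assignment_cost A r \<le> assignment_cost A t"
    and j: "r j = i"
  shows "cramer_vector A w c $ j + A $ i $ j =
    Min (range (\<lambda>k. cramer_vector A w c $ k + A $ i $ k))"
proof -
  let ?T = "\<lambda>k. {t \<in> assignments w. t k = c}"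
  have "r(j := c) \<in> ?T j"
    using r j by (simp add: fun_upd_in_assignments_iff)
  then have "Min (assignment_cost A ` ?T j) \<le> assignment_cost A (r(j := c))"
    by (intro Min_le) auto
  then have upper: "cramer_vector A w c $ j + A $ i $ j \<le> assignment_cost A r"
    using assignment_cost_fun_upd[of A r j c] j by (simp add: cramer_vector_def)
  have lower: "assignment_cost A r \<le> cramer_vector A w c $ k + A $ i $ k" for k
  proof -
    have "Min (assignment_cost A ` ?T k) \<in> assignment_cost A ` ?T k"
      using ne[of k] by (intro Min_in) auto
    then obtain t where t: "t \<in> assignments w" "t k = c"
      "Min (assignment_cost A ` ?T k) = assignment_cost A t" by auto
    have "assignment_cost A r \<le> assignment_cost A (t(k := i))"
      using t by (intro cheapest[of _ k]) (auto simp: fun_upd_idem)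
    also have "\<dots> = cramer_vector A w c $ k + A $ i $ k"
      using assignment_cost_fun_upd[of A t k i] t by (simp add: cramer_vector_def)
    finally show ?thesis .
  qed
  have "Min (range (\<lambda>k. cramer_vector A w c $ k + A $ i $ k)) =
      cramer_vector A w c $ j + A $ i $ j"
    using upper lower by (intro Min_eqI) (auto intro: order_trans)
  then show ?thesis by simp
qed

lemma two_optimal_imp_kernel:
  fixes A :: "real ^ 'n ^ 'm"
  assumes w: "\<And>i. w i \<ge> 1" and "p \<noteq> q"
    and p: "optimal_assignment A w p" and q: "optimal_assignment A w q"
  shows "\<exists>x. x \<in> tw_kernel A w"
proof -
  obtain j\<^sub>0 where j\<^sub>0: "p j\<^sub>0 \<noteq> q j\<^sub>0" using \<open>p \<noteq> q\<close> by auto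
  define c where "c = p j\<^sub>0"
  have ne: "\<exists>t\<in>assignments w. t k = c" for k :: 'n
    using assignment_with_prescribed_value p w unfolding optimal_assignment_def by metis
  let ?M = "\<lambda>i. {j. cramer_vector A w c $ j + A $ i $ j =
    Min (range (\<lambda>k. cramer_vector A w c $ k + A $ i $ k))}"
  have "w i + 1 \<le> card (?M i)" for i
  proof (cases "i = c")
    case True
    \<comment> \<open>Moving a column from \<open>c\<close> to \<open>c\<close> changes nothing, so the cheapest maps are the optimal assignments.\<close>
    have fibre: "{j. r j = c} \<subseteq> ?M c" if r: "optimal_assignment A w r" for r
    proof
      fix j assume "j \<in> {j. r j = c}"
      then have j: "r j = c" by simp
      have "cramer_vector A w c $ j + A $ c $ j =
        Min (range (\<lambda>k. cramer_vector A w c $ k + A $ c $ k))"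
      proof (rule cramer_fibre_attains_min[where r = r and c = c and i = c, OF ne j _ _ j])
        show "r(j := c) \<in> assignments w"
          using r j by (simp add: optimal_assignment_def fun_upd_idem)
        show "assignment_cost A r \<le> assignment_cost A t"
          if "t k = c" "t(k := c) \<in> assignments w" for t k
          using r that by (simp add: optimal_assignment_def fun_upd_idem)
      qed
      then show "j \<in> ?M c" by simp
    qed
    have "insert j\<^sub>0 {j. q j = c} \<subseteq> ?M c"
      using fibre[OF p] fibre[OF q] by (auto simp: c_def)
    then have "card (insert j\<^sub>0 {j. q j = c}) \<le> card (?M c)"
      by (intro card_mono) auto
    moreover have "card (insert j\<^sub>0 {j. q j = c}) = w c + 1"
      using j\<^sub>0 q by (simp add: c_def optimal_assignment_def assignments_def)
    ultimately show ?thesis using True by simp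
  next
    case False
    let ?R = "{t :: 'n \<Rightarrow> 'm. \<exists>k. t k = i \<and> t(k := c) \<in> assignments w}"
    obtain t where t: "t \<in> assignments w" "t j\<^sub>0 = c" using ne by blast
    have "t(j\<^sub>0 := i) \<in> ?R"
      using t by (auto intro!: exI[of _ j\<^sub>0] simp: fun_upd_idem)
    then have "assignment_cost A ` ?R \<noteq> {}" by blast
    then have "Min (assignment_cost A ` ?R) \<in> assignment_cost A ` ?R"
      by (intro Min_in) auto
    then obtain r where r: "Min (assignment_cost A ` ?R) = assignment_cost A r" "r \<in> ?R"
      by (rule imageE)
    have cheapest: "assignment_cost A r \<le> assignment_cost A t"
      if "t k = i" "t(k := c) \<in> assignments w" for t and k :: 'n
      unfolding r(1)[symmetric] using that by (intro Min_le imageI) auto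
    obtain j\<^sub>1 where j\<^sub>1: "r j\<^sub>1 = i" "r(j\<^sub>1 := c) \<in> assignments w" using r(2) by blast
    have "{j. r j = i} \<subseteq> ?M i"
    proof
      fix j assume "j \<in> {j. r j = i}"
      then have j: "r j = i" by simp
      show "j \<in> ?M i"
        using cramer_fibre_attains_min[where r = r and c = c and i = i, OF ne j\<^sub>1 _ j] cheapest
        by simp
    qed
    then have "card {j. r j = i} \<le> card (?M i)"
      by (intro card_mono) auto
    moreover have "card {j. r j = i} = w i + 1"
      using j\<^sub>1(2) False unfolding fun_upd_in_assignments_iff[where r = r, OF j\<^sub>1(1)]
      by (metis add_0_right of_bool_eq(1,2))
    ultimately show ?thesis by simp
  qed
  then have "cramer_vector A w c \<in> tw_kernel A w"
    by (simp add: tw_kernel_def)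
  then show ?thesis ..
qed

section \<open>Tropical singularity and the kernel\<close>

theorem theorem4p5:
  fixes A :: "real ^ 'n ^ 'm" and w :: "'m \<Rightarrow> nat"
  assumes "tw_matrix CARD('n) A w"
  shows "tw_singular A w \<longleftrightarrow> (\<exists>x :: real ^ 'n. x \<in> tw_kernel A w)"
proof -
  have w: "w i \<ge> 1" "(\<Sum>i\<in>UNIV. w i) = CARD('n)" for i
    using assms by (auto simp: tw_matrix_def)
  have ne: "(assignments w :: ('n \<Rightarrow> 'm) set) \<noteq> {}"
    using w(2) by (rule assignments_nonempty)
  show ?thesis
  proof
    assume "tw_singular A w"
    then show "\<exists>x. x \<in> tw_kernel A w"
      using two_optimal_imp_kernel[OF w(1)] by (auto simp: tw_singular_iff_two_optimal[OF ne])
  next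
    assume "\<exists>x. x \<in> tw_kernel A w"
    then obtain x where "x \<in> tw_kernel A w" ..
    moreover obtain p where "optimal_assignment A w p"
      using ex_optimal_assignment[OF ne] by blast
    ultimately show "tw_singular A w"
      unfolding tw_singular_iff_two_optimal[OF ne] using kernel_imp_second_optimum by blast
  qed
qed

end
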